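(* Let $m>n$, let $A\in\mathbb{C}^{m\times n}$ have full rank with rows $A_1,\dots,A_m$, let $b\in\mathbb{C}^m$ (the system $Ax=b$ need not be consistent), let $p\in(0,1]$, and let $x_\star=\arg\min_{x}\frac{1}{2m}\|Ax-b\|^2$. Let $\mathcal{W}\subset\mathbb{C}^n$ be a closed convex set with $x_\star\in\mathcal{W}$ for which $B:=\max_{x\in\mathcal{W}}\|x\|^2$ exists. Let $\mu=\sigma_{\min}^2(A)/m$ and let $(x_k)_{k\ge 1}$ be the iterates of mSGD (defined in the context) with initial point in $\mathcal{W}$ and step sizes $\alpha_k=\frac{1}{\mu k}$. Then for every $k\ge 1$, $$\mathbb{E}\big[\|x_{k+1}-x_\star\|^2\big]\le \frac{17\,G\,(1+\log k)}{\mu^2 k},$$ where $$G=\frac{2B}{mp^2}\left(1+\frac{(1-p)(2-p)}{p}\right)\sum_{i=1}^m\|A_i\|^4+\frac{2}{mp^2}\sum_{i=1}^m\|A_i\|^2|b_i|^2,$$ and this $G$ is an upper bound on the expected squared norm of the update function: $\mathbb{E}[\|g(x)\|^2]\le G$ for all $x\in\mathcal{W}$.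
   Context: Notation: $\|\cdot\|$ is the $\ell_2$-norm, $\sigma_{\min}(A)$ is the smallest singular value of $A$, $A_i$ is the $i$-th row of $A$ (a $1\times n$ vector), $b_i$ is the $i$-th entry of $b$, $(\cdot)^*$ is the conjugate transpose, $\log$ is the natural logarithm, and for a square matrix $M$, $\mathrm{diag}(M)$ is the diagonal matrix with the same diagonal as $M$. Missing data model: $D=(\delta_{i,j})\in\{0,1\}^{m\times n}$ is a random binary mask whose entries are i.i.d. Bernoulli with $P(\delta_{i,j}=1)=p$. The observed matrix is $\tilde A=D\circ A$ (entrywise product), with rows $\tilde A_i$. Update function: for a row index $i$ uniform on $\{1,\dots,m\}$ and independent of $D$, $$g(x)=\frac{1}{p^2}\Big(\tilde A_i^*(\tilde A_i x-p\,b_i)\Big)-\frac{1-p}{p^2}\,\mathrm{diag}(\tilde A_i^*\tilde A_i)\,x .$$ Algorithm mSGD (Stochastic Gradient Descent for Missing Data): start from an initial point $x_1$. At iteration $k=1,2,\dots$, draw a row index $i$ uniformly from $\{1,\dots,m\}$ and a fresh mask $D$, independently of each other and of all previous iterations, form $g(x_k)$ with this $i$ and $D$, and set $x_{k+1}=\mathcal{P}_{\mathcal{W}}(x_k-\alpha_k\,g(x_k))$, where $\mathcal{P}_{\mathcal{W}}$ is the orthogonal projection onto $\mathcal{W}$. The expectation $\mathbb{E}$ is over all random row choices and all masks. *)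

theory Defs
  imports "HOL-Analysis.Analysis" "HOL-Probability.Probability"
begin

definition ctranspose :: "complex^'n^'m \<Rightarrow> complex^'m^'n"
  where "ctranspose A = (\<chi> i j. cnj (A $ j $ i))"

definition diag_part :: "complex^'n^'n \<Rightarrow> complex^'n^'n"
  where "diag_part M = (\<chi> i j. if i = j then M $ i $ j else 0)"

text \<open>
  Square roots of the eigenvalues of the Gram matrix. For matrices with at least as many rows
  as columns these are exactly the usual singular values; for wide matrices the set would
  additionally contain 0.
\<close>

definition singular_values :: "complex^'n^'m \<Rightarrow> real set"
  where "singular_values A =
    {s. 0 \<le> s \<and> (\<exists>v. v \<noteq> 0 \<and> (ctranspose A ** A) *v v = complex_of_real (s\<^sup>2) *s v)}"

definition sigma_min :: "complex^'n^'m \<Rightarrow> real"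
  where "sigma_min A = (LEAST s. s \<in> singular_values A)"

definition masked :: "('m \<times> 'n \<Rightarrow> bool) \<Rightarrow> complex^'n^'m \<Rightarrow> complex^'n^'m"
  where "masked D A = (\<chi> i j. of_bool (D (i, j)) * A $ i $ j)"

text \<open>
  The law of one draw: a uniform row index, paired independently with a mask whose entries are
  i.i.d. Bernoulli(p). The second argument of \<^const>\<open>Pi_pmf\<close> is irrelevant, as the index set
  is everything.
\<close>

definition draw_pmf :: "real \<Rightarrow> ('m::finite \<times> ('m \<times> 'n::finite \<Rightarrow> bool)) pmf"
  where "draw_pmf p =
    pair_pmf (pmf_of_set UNIV) (Pi_pmf UNIV False (\<lambda>_. bernoulli_pmf p))"

text \<open>
  The masked row \<open>r\<close> is kept as a matrix with a single row, so the scalar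
  \<open>r x - p b\<^sub>i\<close> is a vector with one component.
\<close>

definition msgd_update ::
    "real \<Rightarrow> complex^'n^'m \<Rightarrow> complex^'m \<Rightarrow> 'm \<times> ('m \<times> 'n \<Rightarrow> bool) \<Rightarrow> complex^'n \<Rightarrow> complex^'n"
  where "msgd_update p A b d x =
    (let r = (rowvector (row (fst d) (masked (snd d) A)) :: complex^'n^1)
     in (1 / p\<^sup>2) *\<^sub>R (ctranspose r *v (r *v x - p *\<^sub>R vec (b $ fst d)))
        - ((1 - p) / p\<^sup>2) *\<^sub>R (diag_part (ctranspose r ** r) *v x))"

end

theory Submission
  imports Defs
begin

text \<open>
  The update \<open>g\<close> is an unbiased estimate of the gradient \<open>A\<^sup>* (A y - b) / m\<close>, because the mask
  entries satisfy \<open>E \<delta>\<^sub>j = p\<close> and \<open>E \<delta>\<^sub>j \<delta>\<^sub>l = p\<^sup>2\<close> for \<open>j \<noteq> l\<close>. By the normal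
  equation at \<open>xstar\<close>, its expected inner product with \<open>y - xstar\<close> is
  \<open>\<parallel>A (y - xstar)\<parallel>\<^sup>2 / m \<ge> \<mu> \<parallel>y - xstar\<parallel>\<^sup>2\<close>. As the projection onto \<open>W\<close> is nonexpansive and
  \<open>x k\<close> depends only on earlier draws, the mean squared errors satisfy
  \<open>d (k + 1) \<le> (1 - 2 / k) d k + G / (\<mu> k)\<^sup>2\<close>. Induction gives \<open>d (k + 1) \<le> G / (\<mu>\<^sup>2 k)\<close>, which
  is stronger than the claim. For the bound \<open>G\<close> it is enough to estimate the sums over unmasked
  entries by Cauchy-Schwarz and to take the expectation of the single factor \<open>\<delta>\<^sub>j\<close>.
\<close>

section \<open>Linear algebra: smallest singular value and least squares\<close>

text \<open>First-order optimality along a line: the quadratic vanishes at \<open>t = 0\<close>, so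
  this is a minimum and the derivative \<open>2 * c\<close> there is zero. It serves both for the
  minimal singular vector and for the normal equation.\<close>

lemma linear_coeff_zero_if_quadratic_nonneg:
  fixes c q :: real
  assumes "\<And>t. 0 \<le> 2 * t * c + t\<^sup>2 * q"
  shows "c = 0"
proof (rule ccontr)
  assume "c \<noteq> 0"
  \<comment> \<open>With \<open>t = - c / k\<close> the quadratic becomes a positive multiple of
    \<open>q - 2 * k\<close>, which is negative whatever the sign of \<open>q\<close>.\<close>
  define k where "k = \<bar>q\<bar> + 1"
  have k: "0 < k" "q < k" by (auto simp: k_def)
  have "2 * (- c / k) * c + (- c / k)\<^sup>2 * q = c\<^sup>2 * (q - 2 * k) / k\<^sup>2"
    using k by (simp add: field_simps power2_eq_square)
  also have "\<dots> < 0"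
    using k \<open>c \<noteq> 0\<close> by (intro divide_neg_pos mult_pos_neg) auto
  finally show False using assms[of "- c / k"] by simp
qed

lemma inner_complex_eq_Re: "z \<bullet> w = Re (cnj z * w)" for z w :: complex
  by (simp add: inner_complex_def)

text \<open>The inner product on \<open>complex^'n\<close> is the real part of the Hermitian one, so
  the conjugate transpose is also the adjoint for this real inner product.\<close>

lemma inner_ctranspose: "(ctranspose A *v y) \<bullet> z = y \<bullet> (A *v z)"
proof -
  have "(ctranspose A *v y) \<bullet> z = (\<Sum>j\<in>UNIV. \<Sum>i\<in>UNIV. Re (A $ i $ j * cnj (y $ i) * z $ j))"
    by (simp add: inner_vec_def inner_complex_eq_Re matrix_vector_mult_def ctranspose_def
        sum_distrib_right del: times_complex.sel)
  also have "\<dots> = (\<Sum>i\<in>UNIV. \<Sum>j\<in>UNIV. Re (A $ i $ j * cnj (y $ i) * z $ j))"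
    by (rule sum.swap)
  also have "\<dots> = y \<bullet> (A *v z)"
    by (simp add: inner_vec_def inner_complex_eq_Re matrix_vector_mult_def
        sum_distrib_left mult_ac del: times_complex.sel)
  finally show ?thesis .
qed

lemma inner_Gram: "((ctranspose A ** A) *v v) \<bullet> w = (A *v v) \<bullet> (A *v w)"
  by (simp add: inner_ctranspose flip: matrix_vector_mul_assoc)

lemma vector_smult_of_real: "complex_of_real c *s v = c *\<^sub>R v"
  by (simp add: vec_eq_iff scaleR_conv_of_real[where 'a = complex])

lemma norm_add_scaleR_sq:
  "(norm (u + t *\<^sub>R v))\<^sup>2 = (norm u)\<^sup>2 + 2 * t * (u \<bullet> v) + t\<^sup>2 * (norm v)\<^sup>2"
  for u v :: "'a::real_inner"
  unfolding power2_norm_eq_inner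
  by (simp only: inner_add_left inner_add_right inner_scaleR_left inner_scaleR_right
      inner_commute[of v u]) (simp add: power2_eq_square algebra_simps)

lemma matrix_vector_mult_line:
  "A *v (u + t *\<^sub>R v) = A *v u + t *\<^sub>R (A *v v)" for A :: "complex^'n^'m"
  by (simp add: linear_add[OF matrix_vector_mul_linear] linear_scale[OF matrix_vector_mul_linear])

text \<open>By compactness \<open>norm (A *v v)\<close> has a minimum \<open>s\<close> on the unit
  sphere. Stationarity makes the minimiser an eigenvector of the Gram matrix, so \<open>s\<close> is
  a singular value. Every singular value is a ratio \<open>norm (A *v u) / norm u\<close>, hence at
  least \<open>s\<close>, so the \<open>LEAST\<close> in \<open>sigma_min\<close> is
  attained.\<close>

lemma sigma_min_attained:
  fixes A :: "complex^'n^'m"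
  obtains v where "norm v = 1" "sigma_min A = norm (A *v v)"
    "\<And>w. sigma_min A * norm w \<le> norm (A *v w)"
proof -
  have "continuous_on (sphere 0 1) (\<lambda>v. norm (A *v v))"
    by (intro continuous_on_norm linear_continuous_on linear_linear[THEN iffD2] matrix_vector_mul_linear)
  moreover have "compact (sphere (0 :: complex^'n) 1)" "sphere (0 :: complex^'n) 1 \<noteq> {}"
    by simp_all
  ultimately obtain v where v: "norm v = 1"
    and le: "\<And>w. norm w = 1 \<Longrightarrow> norm (A *v v) \<le> norm (A *v w)"
    using continuous_attains_inf[of "sphere 0 1" "\<lambda>v. norm (A *v v)"] by auto
  define s where "s = norm (A *v v)"
  have min: "s * norm w \<le> norm (A *v w)" for w
  proof (cases "w = 0")
    case False
    have "s \<le> norm (A *v ((1 / norm w) *\<^sub>R w))"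
      unfolding s_def using False by (intro le) simp
    also have "A *v ((1 / norm w) *\<^sub>R w) = (1 / norm w) *\<^sub>R (A *v w)"
      using matrix_vector_mult_line[of A 0 "1 / norm w" w] by simp
    finally show ?thesis using False by (simp add: field_simps)
  qed simp
  have "(ctranspose A ** A) *v v = s\<^sup>2 *\<^sub>R v"
  proof -
    have "((ctranspose A ** A) *v v) \<bullet> w = (s\<^sup>2 *\<^sub>R v) \<bullet> w" for w
    proof -
    \<comment> \<open>Minimality at \<open>v + t *\<^sub>R w\<close> gives a nonnegative quadratic
      in \<open>t\<close>; its constant term cancels because \<open>norm v = 1\<close> and
      \<open>norm (A *v v) = s\<close>.\<close>
    have "(A *v v) \<bullet> (A *v w) - s\<^sup>2 * (v \<bullet> w) = 0"
    proof (rule linear_coeff_zero_if_quadratic_nonneg)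
      fix t
      have "(s * norm (v + t *\<^sub>R w))\<^sup>2 \<le> (norm (A *v (v + t *\<^sub>R w)))\<^sup>2"
        by (intro power_mono min) (simp add: s_def)
      then have "s\<^sup>2 * (1 + 2 * t * (v \<bullet> w) + t\<^sup>2 * (norm w)\<^sup>2)
          \<le> s\<^sup>2 + 2 * t * ((A *v v) \<bullet> (A *v w)) + t\<^sup>2 * (norm (A *v w))\<^sup>2"
        by (simp only: power_mult_distrib matrix_vector_mult_line norm_add_scaleR_sq v)
          (simp add: s_def)
      then show "0 \<le> 2 * t * ((A *v v) \<bullet> (A *v w) - s\<^sup>2 * (v \<bullet> w))
          + t\<^sup>2 * ((norm (A *v w))\<^sup>2 - s\<^sup>2 * (norm w)\<^sup>2)"
        by (simp add: algebra_simps)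
    qed
    then show "((ctranspose A ** A) *v v) \<bullet> w = (s\<^sup>2 *\<^sub>R v) \<bullet> w"
      by (simp add: inner_Gram)
    qed
    then show ?thesis
      using vector_eq_rdot by blast
  qed
  moreover have "v \<noteq> 0" using v by auto
  ultimately have "s \<in> singular_values A"
    by (auto simp: singular_values_def vector_smult_of_real s_def intro!: exI[of _ v]
        simp del: of_real_power)
  moreover have "s \<le> s'" if "s' \<in> singular_values A" for s'
  proof -
    from that obtain u where u: "0 \<le> s'" "u \<noteq> 0" "(ctranspose A ** A) *v u = s'\<^sup>2 *\<^sub>R u"
      unfolding singular_values_def vector_smult_of_real by blast
    have "(norm (A *v u))\<^sup>2 = s'\<^sup>2 * (norm u)\<^sup>2"
      using inner_Gram[of A u u] by (simp add: u power2_norm_eq_inner)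
    then have "norm (A *v u) = s' * norm u"
      using u(1) by (simp add: power_mult_distrib[symmetric])
    with min[of u] u(2) show ?thesis by simp
  qed
  ultimately have "sigma_min A = s"
    unfolding sigma_min_def by (rule Least_equality)
  with v min show ?thesis by (intro that[of v]) (auto simp: s_def)
qed

lemma inj_if_full_column_rank:
  fixes A :: "'a::field^'n^'m"
  assumes "rank A = CARD('n)"
  shows "inj ((*v) A)"
proof -
  have "vec.span (rows A) = UNIV"
    using assms by (simp add: row_rank_def_gen vec.dimension_def card_cart_basis flip: vec.dim_eq_full)
  then show ?thesis
    by (simp add: matrix_left_invertible_span_rows_gen flip: matrix_left_invertible_injective)
qed

text \<open>The minimum is attained at a unit vector, which an injective map cannot send to 0. This
  makes \<open>\<mu>\<close> positive and the step sizes meaningful.\<close>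

lemma sigma_min_pos:
  fixes A :: "complex^'n^'m"
  assumes "rank A = CARD('n)"
  shows "0 < sigma_min A"
proof -
  obtain v where v: "norm v = 1" "sigma_min A = norm (A *v v)"
    by (rule sigma_min_attained)
  have "A *v v \<noteq> A *v 0"
    using inj_if_full_column_rank[OF assms] v(1) by (metis injD norm_zero zero_neq_one)
  then show ?thesis by (simp add: v)
qed

text \<open>Perturbing the minimiser along \<open>z\<close> shows that the residual is orthogonal to
  the range of \<open>A\<close>.\<close>

lemma least_squares_normal_equation:
  fixes A :: "complex^'n^'m"
  assumes "\<And>y. norm (A *v xstar - b) \<le> norm (A *v y - b)"
  shows "(A *v xstar - b) \<bullet> (A *v z) = 0"
proof (rule linear_coeff_zero_if_quadratic_nonneg)
  fix t
  have "(norm (A *v xstar - b))\<^sup>2 \<le> (norm (A *v (xstar + t *\<^sub>R z) - b))\<^sup>2"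
    by (intro power_mono assms) simp
  also have "A *v (xstar + t *\<^sub>R z) - b = (A *v xstar - b) + t *\<^sub>R (A *v z)"
    by (simp add: matrix_vector_mult_line)
  finally show "0 \<le> 2 * t * ((A *v xstar - b) \<bullet> (A *v z)) + t\<^sup>2 * (norm (A *v z))\<^sup>2"
    by (simp only: norm_add_scaleR_sq)
qed

section \<open>Moments of the mask and the mean of the update\<close>

lemma expectation_prod_bernoulli_mask:
  fixes S :: "'a::finite set"
  assumes "0 \<le> p" "p \<le> 1"
  shows "measure_pmf.expectation (Pi_pmf UNIV dflt (\<lambda>_. bernoulli_pmf p))
           (\<lambda>D. \<Prod>x\<in>S. of_bool (D x)) = p ^ card S"
proof -
  \<comment> \<open>Padding with factors 1 outside \<open>S\<close> turns the product into one over
    all coordinates, which independence factorises.\<close>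
  let ?f = "\<lambda>x v. if x \<in> S then of_bool v else 1 :: real"
  have "measure_pmf.expectation (Pi_pmf UNIV dflt (\<lambda>_. bernoulli_pmf p)) (\<lambda>D. \<Prod>x\<in>S. of_bool (D x))
      = measure_pmf.expectation (Pi_pmf UNIV dflt (\<lambda>_. bernoulli_pmf p)) (\<lambda>D. \<Prod>x\<in>UNIV. ?f x (D x))"
    by (simp add: prod.If_cases)
  also have "\<dots> = (\<Prod>x\<in>UNIV. measure_pmf.expectation (bernoulli_pmf p) (?f x))"
    by (rule expectation_prod_Pi_pmf) (auto intro: integrable_measure_pmf_finite)
  also have "\<dots> = (\<Prod>x\<in>UNIV. if x \<in> S then p else 1)"
    using assms by (intro prod.cong) auto
  also have "\<dots> = p ^ card S"
    by (simp add: prod.If_cases)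
  finally show ?thesis .
qed

lemma expectation_mask_entry:
  fixes a :: "'a::finite"
  assumes "0 \<le> p" "p \<le> 1"
  shows "measure_pmf.expectation (Pi_pmf UNIV dflt (\<lambda>_. bernoulli_pmf p)) (\<lambda>D. of_bool (D a)) = p"
  using expectation_prod_bernoulli_mask[OF assms, of dflt "{a}"] by simp

lemma expectation_mask_two_entries:
  fixes a b :: "'a::finite"
  assumes "0 \<le> p" "p \<le> 1" "a \<noteq> b"
  shows "measure_pmf.expectation (Pi_pmf UNIV dflt (\<lambda>_. bernoulli_pmf p))
           (\<lambda>D. of_bool (D a) * of_bool (D b)) = p\<^sup>2"
  using expectation_prod_bernoulli_mask[OF assms(1,2), of dflt "{a, b}"] assms(3)
  by (simp add: power2_eq_square)

lemma integrable_pmf_finite_type [simp]: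
  fixes f :: "'a::finite \<Rightarrow> 'b::{banach, second_countable_topology}"
  shows "integrable (measure_pmf q) f"
  by (rule integrable_measure_pmf_finite) simp

lemma expectation_draw:
  fixes f :: "'m::finite \<times> ('m \<times> 'n::finite \<Rightarrow> bool) \<Rightarrow> real"
  shows "measure_pmf.expectation (draw_pmf p) f =
    (\<Sum>i\<in>UNIV. measure_pmf.expectation (Pi_pmf UNIV False (\<lambda>_. bernoulli_pmf p)) (\<lambda>D. f (i, D)))
      / real CARD('m)"
proof -
  let ?mask = "Pi_pmf UNIV False (\<lambda>_. bernoulli_pmf p) :: ('m \<times> 'n \<Rightarrow> bool) pmf"
  have "measure_pmf.expectation (draw_pmf p) f = (\<Sum>x\<in>UNIV. pmf (pair_pmf (pmf_of_set UNIV) ?mask) x * f x)"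
    unfolding draw_pmf_def by (subst integral_measure_pmf[of UNIV]) simp_all
  also have "\<dots> = (\<Sum>x\<in>UNIV \<times> UNIV. pmf (pair_pmf (pmf_of_set UNIV) ?mask) x * f x)"
    by (simp only: UNIV_Times_UNIV)
  also have "\<dots> = (\<Sum>i\<in>UNIV. \<Sum>D\<in>UNIV. pmf (pair_pmf (pmf_of_set UNIV) ?mask) (i, D) * f (i, D))"
    unfolding sum.cartesian_product by (rule sum.cong) auto
  also have "\<dots> = (\<Sum>i\<in>UNIV. \<Sum>D\<in>UNIV. pmf ?mask D * f (i, D)) / real CARD('m)"
    by (simp add: pmf_pair sum_divide_distrib)
  also have "\<dots> = (\<Sum>i\<in>UNIV. measure_pmf.expectation ?mask (\<lambda>D. f (i, D))) / real CARD('m)"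
    by (subst integral_measure_pmf[of UNIV]) simp_all
  finally show ?thesis .
qed

text \<open>The diagonal correction takes \<open>1 - p\<close> away from the weight of the term
  \<open>l = j\<close>, which is 1 when entry \<open>j\<close> is observed; the weight
  \<open>p\<close> remains. It thus repairs the bias caused by
  \<open>\<delta>\<^sub>j\<^sup>2 = \<delta>\<^sub>j\<close>. If entry \<open>j\<close> is masked,
  both sides vanish.\<close>

lemma msgd_update_nth:
  "msgd_update p A b (i, D) y $ j =
     (of_bool (D (i, j)) / p\<^sup>2) *\<^sub>R (cnj (A $ i $ j) *
       ((\<Sum>l\<in>UNIV. (if l = j then p else of_bool (D (i, l))) *\<^sub>R (A $ i $ l * y $ l)) - p *\<^sub>R b $ i))"
proof -
  define r where "r l = of_bool (D (i, l)) * A $ i $ l" for l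
  have g: "msgd_update p A b (i, D) y $ j = (1 / p\<^sup>2) *\<^sub>R (cnj (r j) * ((\<Sum>l\<in>UNIV. r l * y $ l) - p *\<^sub>R b $ i))
      - ((1 - p) / p\<^sup>2) *\<^sub>R (cnj (r j) * r j * y $ j)"
    by (simp add: msgd_update_def Let_def matrix_vector_mult_def matrix_matrix_mult_def
        ctranspose_def diag_part_def rowvector_def row_def masked_def UNIV_1 r_def
        if_distrib[of "\<lambda>x. x * _"] cong: if_cong)
  show ?thesis
  proof (cases "D (i, j)")
    case True
    have "(\<Sum>l\<in>UNIV. (if l = j then p else of_bool (D (i, l))) *\<^sub>R (A $ i $ l * y $ l))
        = p *\<^sub>R (A $ i $ j * y $ j) + (\<Sum>l\<in>UNIV - {j}. r l * y $ l)"
      by (subst sum.remove[of UNIV j])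
        (auto simp: r_def of_bool_def intro!: sum.cong split: if_splits)
    moreover have "(\<Sum>l\<in>UNIV. r l * y $ l) = A $ i $ j * y $ j + (\<Sum>l\<in>UNIV - {j}. r l * y $ l)"
      using True by (subst sum.remove[of UNIV j]) (auto simp: r_def)
    moreover have "r j = A $ i $ j"
      using True by (simp add: r_def)
    ultimately show ?thesis
      unfolding g using True by (simp add: scaleR_conv_of_real diff_divide_distrib algebra_simps)
  qed (simp add: g r_def)
qed

lemma mult_cnj_inner: "(cnj a * c) \<bullet> z = c \<bullet> (a * z)" for a c z :: complex
  by (simp add: inner_complex_def algebra_simps)

lemma expectation_msgd_update_inner:
  fixes A :: "complex^'n^'m"
  assumes "0 < p" "p \<le> 1"
  shows "measure_pmf.expectation (draw_pmf p) (\<lambda>d. msgd_update p A b d y \<bullet> z)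
    = (A *v y - b) \<bullet> (A *v z) / real CARD('m)"
proof -
  let ?mask = "Pi_pmf UNIV False (\<lambda>_. bernoulli_pmf p) :: ('m \<times> 'n \<Rightarrow> bool) pmf"
  have "measure_pmf.expectation ?mask (\<lambda>D. msgd_update p A b (i, D) y \<bullet> z)
      = (A *v y - b) $ i \<bullet> (A *v z) $ i" for i
  proof -
    \<comment> \<open>All these weights have the same mean \<open>p^2\<close>, as
      \<open>p * p\<close> on the diagonal and as two independent entries off it; this cancels the
      factor \<open>1 / p^2\<close> of the update.\<close>
    define w where "w D j l = of_bool (D (i, j)) * (if l = j then p else of_bool (D (i, l)))"
      for D :: "'m \<times> 'n \<Rightarrow> bool" and j l
    have w: "measure_pmf.expectation ?mask (\<lambda>D. w D j l) = p\<^sup>2" for j l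
      using assms expectation_mask_entry[of p False "(i, j)"] expectation_mask_two_entries[of p "(i, j)" "(i, l)" False]
      by (cases "l = j") (auto simp: w_def power2_eq_square)
    have "msgd_update p A b (i, D) y \<bullet> z =
        (\<Sum>j\<in>UNIV. (\<Sum>l\<in>UNIV. w D j l * ((A $ i $ l * y $ l) \<bullet> (A $ i $ j * z $ j)))
          - of_bool (D (i, j)) * (p * (b $ i \<bullet> (A $ i $ j * z $ j)))) / p\<^sup>2" for D
      unfolding inner_vec_def sum_divide_distrib
    proof (rule sum.cong)
      fix j
      show "msgd_update p A b (i, D) y $ j \<bullet> z $ j =
        ((\<Sum>l\<in>UNIV. w D j l * ((A $ i $ l * y $ l) \<bullet> (A $ i $ j * z $ j)))
          - of_bool (D (i, j)) * (p * (b $ i \<bullet> (A $ i $ j * z $ j)))) / p\<^sup>2"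
        by (cases "D (i, j)")
          (simp_all add: msgd_update_nth mult_cnj_inner inner_diff_left inner_sum_left w_def)
    qed simp
    then have "measure_pmf.expectation ?mask (\<lambda>D. msgd_update p A b (i, D) y \<bullet> z) =
        (\<Sum>j\<in>UNIV. (\<Sum>l\<in>UNIV. p\<^sup>2 * ((A $ i $ l * y $ l) \<bullet> (A $ i $ j * z $ j)))
          - p * (p * (b $ i \<bullet> (A $ i $ j * z $ j)))) / p\<^sup>2"
      using assms by (simp add: w expectation_mask_entry)
    also have "\<dots> = (\<Sum>j\<in>UNIV. (\<Sum>l\<in>UNIV. (A $ i $ l * y $ l) \<bullet> (A $ i $ j * z $ j))
          - b $ i \<bullet> (A $ i $ j * z $ j))"
      using assms by (simp add: sum_divide_distrib diff_divide_distrib power2_eq_square)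
    also have "\<dots> = (\<Sum>j\<in>UNIV. (A *v y - b) $ i \<bullet> (A $ i $ j * z $ j))"
      by (simp add: matrix_vector_mult_def inner_diff_left inner_sum_left)
    also have "\<dots> = (A *v y - b) $ i \<bullet> (A *v z) $ i"
      by (simp add: matrix_vector_mult_def inner_sum_right)
    finally show ?thesis .
  qed
  then show ?thesis
    by (simp add: expectation_draw inner_vec_def)
qed

section \<open>Second moment of the update\<close>

lemma norm_sum_mult_le:
  fixes a y :: "complex^'n"
  assumes "\<And>l. \<bar>\<theta> l\<bar> \<le> 1"
  shows "norm (\<Sum>l\<in>UNIV. \<theta> l *\<^sub>R (a $ l * y $ l)) \<le> norm a * norm y"
proof -
  have "norm (\<Sum>l\<in>UNIV. \<theta> l *\<^sub>R (a $ l * y $ l)) \<le> (\<Sum>l\<in>UNIV. \<bar>norm (a $ l)\<bar> * \<bar>norm (y $ l)\<bar>)"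
  proof (rule sum_norm_le)
    fix l
    show "norm (\<theta> l *\<^sub>R (a $ l * y $ l)) \<le> \<bar>norm (a $ l)\<bar> * \<bar>norm (y $ l)\<bar>"
      using mult_right_mono[OF assms[of l], of "norm (a $ l) * norm (y $ l)"] by (simp add: norm_mult)
  qed
  also have "\<dots> \<le> norm a * norm y"
    unfolding norm_vec_def by (rule L2_set_mult_ineq)
  finally show ?thesis .
qed

lemma norm_vec_sq: "(norm v)\<^sup>2 = (\<Sum>j\<in>UNIV. (norm (v $ j))\<^sup>2)"
  for v :: "'a::real_normed_vector^'n"
  by (simp add: norm_vec_def L2_set_def sum_nonneg)

text \<open>The inner sum has weights in \<open>[0, 1]\<close>, so Cauchy-Schwarz bounds it
  uniformly in the mask. Only the outer factor \<open>of_bool (D (i, j))\<close> stays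
  random.\<close>

lemma norm_msgd_update_le:
  fixes A :: "complex^'n^'m"
  assumes "0 < p" "p \<le> 1"
  shows "(norm (msgd_update p A b (i, D) y))\<^sup>2 \<le>
    (\<Sum>j\<in>UNIV. of_bool (D (i, j)) * (norm (A $ i $ j))\<^sup>2)
      * (2 * (norm (row i A))\<^sup>2 * (norm y)\<^sup>2 + 2 * p\<^sup>2 * (norm (b $ i))\<^sup>2) / p ^ 4"
proof -
  let ?C = "2 * (norm (row i A))\<^sup>2 * (norm y)\<^sup>2 + 2 * p\<^sup>2 * (norm (b $ i))\<^sup>2"
  have "(norm (msgd_update p A b (i, D) y $ j))\<^sup>2 \<le> of_bool (D (i, j)) * (norm (A $ i $ j))\<^sup>2 * ?C / p ^ 4" for j
  proof -
    define S where "S = (\<Sum>l\<in>UNIV. (if l = j then p else of_bool (D (i, l))) *\<^sub>R (A $ i $ l * y $ l))"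
    have S: "norm S \<le> norm (row i A) * norm y"
      using norm_sum_mult_le[of "\<lambda>l. if l = j then p else of_bool (D (i, l))" "row i A" y] assms
      by (simp add: S_def row_def)
    have "norm (S - p *\<^sub>R b $ i) \<le> norm (row i A) * norm y + p * norm (b $ i)"
      using norm_triangle_ineq4[of S "p *\<^sub>R b $ i"] S assms by simp
    then have "(norm (S - p *\<^sub>R b $ i))\<^sup>2 \<le> (norm (row i A) * norm y + p * norm (b $ i))\<^sup>2"
      by (rule power_mono) simp
    \<comment> \<open>This is \<open>(u + v)^2 \<le> 2 * u^2 + 2 * v^2\<close>, obtained from
      \<open>0 \<le> (u - v)^2\<close>.\<close>
    also have "\<dots> \<le> ?C"
      using zero_le_power2[of "norm (row i A) * norm y - p * norm (b $ i)"]
      by (simp add: power2_eq_square algebra_simps)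
    finally have le: "(norm (S - p *\<^sub>R b $ i))\<^sup>2 \<le> ?C" .
    have "(norm (msgd_update p A b (i, D) y $ j))\<^sup>2
        = of_bool (D (i, j)) * (norm (A $ i $ j))\<^sup>2 * (norm (S - p *\<^sub>R b $ i))\<^sup>2 / p ^ 4"
      by (simp add: msgd_update_nth norm_mult power_mult_distrib power_divide flip: S_def)
    also have "\<dots> \<le> of_bool (D (i, j)) * (norm (A $ i $ j))\<^sup>2 * ?C / p ^ 4"
      using assms by (intro divide_right_mono mult_left_mono le) auto
    finally show ?thesis .
  qed
  then show ?thesis
    unfolding norm_vec_sq[of "msgd_update p A b (i, D) y"] sum_distrib_right sum_divide_distrib
    by (rule sum_mono)
qed

lemma expectation_norm_msgd_update_le:
  fixes A :: "complex^'n^'m"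
  assumes p: "0 < p" "p \<le> 1" and B: "(norm y)\<^sup>2 \<le> B"
  shows "measure_pmf.expectation (draw_pmf p) (\<lambda>d. (norm (msgd_update p A b d y))\<^sup>2) \<le>
    2 * B / (real CARD('m) * p\<^sup>2) * (1 + (1 - p) * (2 - p) / p) * (\<Sum>i\<in>UNIV. norm (row i A) ^ 4)
      + 2 / (real CARD('m) * p\<^sup>2) * (\<Sum>i\<in>UNIV. (norm (row i A))\<^sup>2 * (norm (b $ i))\<^sup>2)"
proof -
  let ?mask = "Pi_pmf UNIV False (\<lambda>_. bernoulli_pmf p) :: ('m \<times> 'n \<Rightarrow> bool) pmf"
  define K where "K = 2 * B / p\<^sup>2 * (1 + (1 - p) * (2 - p) / p)"
  have B0: "0 \<le> B" using B zero_le_power2 order_trans by blast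
  (* (1 + (1 - p) (2 - p) / p) / p^2 = (1 + (1 - p)^2) / p^3, so the crude pointwise bound suffices *)
  have K: "2 * B / p ^ 3 \<le> K"
  proof -
    have "K = 2 * B / p ^ 3 + 2 * B * (1 - p)\<^sup>2 / p ^ 3"
      using p by (simp add: K_def field_simps power2_eq_square power3_eq_cube)
    then show ?thesis using p B0 by simp
  qed
  have row: "measure_pmf.expectation ?mask (\<lambda>D. (norm (msgd_update p A b (i, D) y))\<^sup>2)
      \<le> K * norm (row i A) ^ 4 + 2 / p\<^sup>2 * ((norm (row i A))\<^sup>2 * (norm (b $ i))\<^sup>2)" for i
  proof -
    let ?C = "2 * (norm (row i A))\<^sup>2 * (norm y)\<^sup>2 + 2 * p\<^sup>2 * (norm (b $ i))\<^sup>2"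
    have "measure_pmf.expectation ?mask (\<lambda>D. (norm (msgd_update p A b (i, D) y))\<^sup>2)
        \<le> measure_pmf.expectation ?mask (\<lambda>D. (\<Sum>j\<in>UNIV. of_bool (D (i, j)) * (norm (A $ i $ j))\<^sup>2) * ?C / p ^ 4)"
      using p by (intro integral_mono norm_msgd_update_le) simp_all
    \<comment> \<open>The remaining mask factor has mean \<open>p\<close>, which lowers the power of
      \<open>p\<close> in the denominator to 3.\<close>
    also have "\<dots> = p * (norm (row i A))\<^sup>2 * ?C / p ^ 4"
      using p by (simp add: expectation_mask_entry sum_distrib_left[symmetric] norm_vec_sq[of "A $ i"] row_def
          del: sum_of_bool_mult_eq sum_mult_of_bool_eq)
    also have "\<dots> = 2 * (norm y)\<^sup>2 / p ^ 3 * norm (row i A) ^ 4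
        + 2 / p * ((norm (row i A))\<^sup>2 * (norm (b $ i))\<^sup>2)"
      using p by (simp add: field_simps power2_eq_square power3_eq_cube power4_eq_xxxx)
    also have "\<dots> \<le> K * norm (row i A) ^ 4 + 2 / p\<^sup>2 * ((norm (row i A))\<^sup>2 * (norm (b $ i))\<^sup>2)"
    proof (intro add_mono mult_right_mono)
      have "2 * (norm y)\<^sup>2 / p ^ 3 \<le> 2 * B / p ^ 3"
        using B p by (intro divide_right_mono) auto
      then show "2 * (norm y)\<^sup>2 / p ^ 3 \<le> K"
        using K by linarith
      have "p\<^sup>2 \<le> p"
        using p by (simp add: power2_eq_square mult_left_le)
      then show "2 / p \<le> 2 / p\<^sup>2"
        using p by (intro divide_left_mono) auto
    qed auto
    finally show ?thesis .
  qed
  have "measure_pmf.expectation (draw_pmf p) (\<lambda>d. (norm (msgd_update p A b d y))\<^sup>2)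
      \<le> (\<Sum>i\<in>UNIV. K * norm (row i A) ^ 4 + 2 / p\<^sup>2 * ((norm (row i A))\<^sup>2 * (norm (b $ i))\<^sup>2))
        / real CARD('m)"
    unfolding expectation_draw by (intro divide_right_mono sum_mono row) simp
  also have "\<dots> = 2 * B / (real CARD('m) * p\<^sup>2) * (1 + (1 - p) * (2 - p) / p) * (\<Sum>i\<in>UNIV. norm (row i A) ^ 4)
      + 2 / (real CARD('m) * p\<^sup>2) * (\<Sum>i\<in>UNIV. (norm (row i A))\<^sup>2 * (norm (b $ i))\<^sup>2)"
    unfolding sum.distrib sum_distrib_left[symmetric] add_divide_distrib K_def by (simp add: mult_ac)
  finally show ?thesis .
qed

section \<open>Independence of an iterate from the current draw\<close>

context prob_space
begin

text \<open>Unrolling the recursion uses only the draws with index strictly below \<open>k\<close>,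
  so draw \<open>k\<close> is still fresh when it meets iterate \<open>k\<close>.\<close>

lemma iterate_eq_function_of_past:
  assumes init: "\<And>\<omega>. \<omega> \<in> space M \<Longrightarrow> X 1 \<omega> = x1"
    and step: "\<And>k \<omega>. 1 \<le> k \<Longrightarrow> \<omega> \<in> space M \<Longrightarrow> X (Suc k) \<omega> = T k (\<xi> k \<omega>) (X k \<omega>)"
    and "1 \<le> k"
  shows "\<exists>F. \<forall>\<omega>\<in>space M. X k \<omega> = F (restrict (\<lambda>i. \<xi> i \<omega>) {1..<k})"
  using \<open>1 \<le> k\<close>
proof (induction k rule: dec_induct)
  case base
  show ?case by (rule exI[of _ "\<lambda>_. x1"]) (simp add: init[simplified])
next
  case (step k)
  then obtain F where F: "\<forall>\<omega>\<in>space M. X k \<omega> = F (restrict (\<lambda>i. \<xi> i \<omega>) {1..<k})"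
    by blast
  have "restrict (restrict (\<lambda>i. \<xi> i \<omega>) {1..<Suc k}) {1..<k} = restrict (\<lambda>i. \<xi> i \<omega>) {1..<k}" for \<omega>
    by (auto simp: restrict_def fun_eq_iff)
  with F step.hyps assms(2) show ?case
    by (intro exI[of _ "\<lambda>f. T k (f k) (F (restrict f {1..<k}))"]) (simp del: restrict_apply One_nat_def add: restrict_apply')
qed

text \<open>Conditioning on the past without conditional expectations: split over the finitely many
  values \<open>d\<close> of the draw. Each indicator of \<open>\<xi> k \<omega> = d\<close> is
  independent of the iterate and has mean \<open>pmf q d\<close>.\<close>

lemma
  fixes \<xi> :: "nat \<Rightarrow> 'a \<Rightarrow> 'd::finite" and f :: "'x \<Rightarrow> real" and h :: "'d \<Rightarrow> 'x \<Rightarrow> real"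
  assumes indep: "indep_vars (\<lambda>_. count_space UNIV) \<xi> {1..}"
    and distr: "distr M (count_space UNIV) (\<xi> k) = measure_pmf q"
    and init: "\<And>\<omega>. \<omega> \<in> space M \<Longrightarrow> X 1 \<omega> = x1"
    and step: "\<And>k \<omega>. 1 \<le> k \<Longrightarrow> \<omega> \<in> space M \<Longrightarrow> X (Suc k) \<omega> = T k (\<xi> k \<omega>) (X k \<omega>)"
    and k: "1 \<le> k"
  shows integrable_iterate: "integrable M (\<lambda>\<omega>. f (X k \<omega>))"
    and expectation_iterate_step: "expectation (\<lambda>\<omega>. h (\<xi> k \<omega>) (X k \<omega>))
      = expectation (\<lambda>\<omega>. measure_pmf.expectation q (\<lambda>d. h d (X k \<omega>)))"
proof -
  obtain F where F: "\<And>\<omega>. \<omega> \<in> space M \<Longrightarrow> X k \<omega> = F (restrict (\<lambda>i. \<xi> i \<omega>) {1..<k})"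
    using iterate_eq_function_of_past[where X = X and T = T and \<xi> = \<xi>, OF init step k] by blast
  let ?past = "\<lambda>\<omega>. restrict (\<lambda>i. \<xi> i \<omega>) {1..<k}"
  let ?E = "{1..<k} \<rightarrow>\<^sub>E (UNIV :: 'd set)"
  have iv: "indep_var (count_space ?E) ?past
      (count_space ({k} \<rightarrow>\<^sub>E UNIV)) (\<lambda>\<omega>. restrict (\<lambda>i. \<xi> i \<omega>) {k})"
    using indep_var_restrict[OF indep, of "{1..<k}" "{k}"] k
    by (simp add: count_space_PiM_finite subset_iff)
  have past [measurable]: "?past \<in> measurable M (count_space ?E)"
    using iv by (rule indep_var_rv1)
  have \<xi>_meas [measurable]: "\<xi> k \<in> measurable M (count_space UNIV)"
    using indep k by (auto simp: indep_vars_def)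
  \<comment> \<open>The past takes finitely many values, so any real function of the iterate is
    measurable and bounded by a finite sum. A general \<open>g\<close> is stated because the
    functions \<open>h d\<close> are integrated as well.\<close>
  have int: "integrable M (\<lambda>\<omega>. g (X k \<omega>))" for g :: "'x \<Rightarrow> real"
  proof -
    have "integrable M (\<lambda>\<omega>. g (F (?past \<omega>)))"
    proof (rule integrable_const_bound)
      show "AE \<omega> in M. norm (g (F (?past \<omega>))) \<le> (\<Sum>v\<in>?E. norm (g (F v)))"
        by (intro AE_I2 member_le_sum[of _ ?E "\<lambda>v. norm (g (F v))"]) (auto intro: finite_PiE)
      show "(\<lambda>\<omega>. g (F (?past \<omega>))) \<in> borel_measurable M"
        by (rule measurable_compose[OF past]) simp
    qed
    then show ?thesis
      by (rule Bochner_Integration.integrable_cong[THEN iffD1, rotated -1]) (simp_all add: F)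
  qed
  show "integrable M (\<lambda>\<omega>. f (X k \<omega>))" by (rule int)
  have hd: "integrable M (\<lambda>\<omega>. h d (X k \<omega>) * of_bool (\<xi> k \<omega> = d)) \<and>
      expectation (\<lambda>\<omega>. h d (X k \<omega>) * of_bool (\<xi> k \<omega> = d)) = pmf q d * expectation (\<lambda>\<omega>. h d (X k \<omega>))" for d
  proof -
    have "indep_var borel ((\<lambda>v. h d (F v)) \<circ> ?past)
        borel ((\<lambda>v. of_bool (v k = d) :: real) \<circ> (\<lambda>\<omega>. restrict (\<lambda>i. \<xi> i \<omega>) {k}))"
      by (rule indep_var_compose[OF iv]) simp_all
    then have ind: "indep_var borel (\<lambda>\<omega>. h d (F (?past \<omega>))) borel (\<lambda>\<omega>. of_bool (\<xi> k \<omega> = d) :: real)"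
      by (simp add: o_def)
    have i1: "integrable M (\<lambda>\<omega>. h d (F (?past \<omega>)))"
      using int[of "h d"] by (rule Bochner_Integration.integrable_cong[THEN iffD1, rotated -1]) (simp_all add: F)
    have i2: "integrable M (\<lambda>\<omega>. of_bool (\<xi> k \<omega> = d) :: real)"
      using ind by (intro integrable_const_bound[of _ 1]) (auto dest: indep_var_rv2)
    have "expectation (\<lambda>\<omega>. of_bool (\<xi> k \<omega> = d))
        = integral\<^sup>L (distr M (count_space UNIV) (\<xi> k)) (\<lambda>e. of_bool (e = d) :: real)"
      by (subst integral_distr) simp_all
    also have "\<dots> = pmf q d"
      unfolding distr by (subst integral_measure_pmf[of "{d}"]) auto
    finally have "expectation (\<lambda>\<omega>. of_bool (\<xi> k \<omega> = d)) = pmf q d" .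
    with indep_var_lebesgue_integral[OF ind i1 i2] indep_var_integrable[OF ind i1 i2]
    show ?thesis
      by (simp add: F cong: Bochner_Integration.integrable_cong Bochner_Integration.integral_cong)
  qed
  have "expectation (\<lambda>\<omega>. h (\<xi> k \<omega>) (X k \<omega>))
      = expectation (\<lambda>\<omega>. \<Sum>d\<in>UNIV. h d (X k \<omega>) * of_bool (\<xi> k \<omega> = d))"
    by (simp add: of_bool_def if_distrib sum.delta' cong: if_cong)
  also have "\<dots> = (\<Sum>d\<in>UNIV. expectation (\<lambda>\<omega>. h d (X k \<omega>) * of_bool (\<xi> k \<omega> = d)))"
    using hd by (intro Bochner_Integration.integral_sum) blast
  also have "\<dots> = (\<Sum>d\<in>UNIV. pmf q d * expectation (\<lambda>\<omega>. h d (X k \<omega>)))"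
    using hd by (intro sum.cong) blast+
  also have "\<dots> = expectation (\<lambda>\<omega>. measure_pmf.expectation q (\<lambda>d. h d (X k \<omega>)))"
    by (subst integral_measure_pmf[of UNIV]) (simp_all add: int)
  finally show "expectation (\<lambda>\<omega>. h (\<xi> k \<omega>) (X k \<omega>))
      = expectation (\<lambda>\<omega>. measure_pmf.expectation q (\<lambda>d. h d (X k \<omega>)))" .
qed

end

section \<open>One projected step and the resulting recursion\<close>

text \<open>Since \<open>xstar\<close> is its own projection, nonexpansiveness removes the
  projection. Expanding the square leaves a cross term, controlled by strong convexity, and a term
  controlled by \<open>G\<close>.\<close>

lemma expected_projected_step_le:
  fixes A :: "complex^'n^'m"
  assumes p: "0 < p" "p \<le> 1"
    and opt: "\<And>y. norm (A *v xstar - b) \<le> norm (A *v y - b)"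
    and W: "closed W" "convex W" "xstar \<in> W"
    and \<mu>: "\<mu> = (sigma_min A)\<^sup>2 / real CARD('m)"
    and G: "measure_pmf.expectation (draw_pmf p) (\<lambda>d. (norm (msgd_update p A b d y))\<^sup>2) \<le> G"
    and \<alpha>: "0 \<le> \<alpha>"
  shows "measure_pmf.expectation (draw_pmf p)
      (\<lambda>d. (norm (closest_point W (y - \<alpha> *\<^sub>R msgd_update p A b d y) - xstar))\<^sup>2)
    \<le> (1 - 2 * \<alpha> * \<mu>) * (norm (y - xstar))\<^sup>2 + \<alpha>\<^sup>2 * G"
proof -
  let ?E = "measure_pmf.expectation (draw_pmf p :: ('m \<times> ('m \<times> 'n \<Rightarrow> bool)) pmf)"
  let ?g = "\<lambda>d. msgd_update p A b d y"
  have "(norm (closest_point W (y - \<alpha> *\<^sub>R ?g d) - xstar))\<^sup>2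
      \<le> (norm (y - xstar))\<^sup>2 - 2 * \<alpha> * (?g d \<bullet> (y - xstar)) + \<alpha>\<^sup>2 * (norm (?g d))\<^sup>2" for d
  proof -
    have "norm (closest_point W (y - \<alpha> *\<^sub>R ?g d) - xstar) \<le> norm (y - \<alpha> *\<^sub>R ?g d - xstar)"
      using closest_point_lipschitz[of W "y - \<alpha> *\<^sub>R ?g d" xstar] W
      by (auto simp: closest_point_self dist_norm)
    then have "(norm (closest_point W (y - \<alpha> *\<^sub>R ?g d) - xstar))\<^sup>2 \<le> (norm ((y - xstar) + (- \<alpha>) *\<^sub>R ?g d))\<^sup>2"
      by (intro power_mono) (simp_all add: algebra_simps)
    then show ?thesis
      by (simp only: norm_add_scaleR_sq) (simp add: inner_commute)
  qed
  then have "?E (\<lambda>d. (norm (closest_point W (y - \<alpha> *\<^sub>R ?g d) - xstar))\<^sup>2)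
      \<le> ?E (\<lambda>d. (norm (y - xstar))\<^sup>2 - 2 * \<alpha> * (?g d \<bullet> (y - xstar)) + \<alpha>\<^sup>2 * (norm (?g d))\<^sup>2)"
    by (intro integral_mono) simp_all
  also have "\<dots> = (norm (y - xstar))\<^sup>2 - 2 * \<alpha> * ?E (\<lambda>d. ?g d \<bullet> (y - xstar)) + \<alpha>\<^sup>2 * ?E (\<lambda>d. (norm (?g d))\<^sup>2)"
    by simp
  also have "\<dots> \<le> (norm (y - xstar))\<^sup>2 - 2 * \<alpha> * (\<mu> * (norm (y - xstar))\<^sup>2) + \<alpha>\<^sup>2 * G"
  proof (intro add_mono diff_mono mult_left_mono order_refl G)
    have "0 \<le> sigma_min A" "\<And>w. sigma_min A * norm w \<le> norm (A *v w)"
      by (metis sigma_min_attained norm_ge_zero)+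
    then have "(sigma_min A * norm (y - xstar))\<^sup>2 \<le> (norm (A *v (y - xstar)))\<^sup>2"
      by (intro power_mono) auto
    \<comment> \<open>The residual at \<open>xstar\<close> is orthogonal to the range of
      \<open>A\<close>, so it may be added to \<open>A *v (y - xstar)\<close>; the system itself may
      be inconsistent.\<close>
    also have "\<dots> = (A *v y - b) \<bullet> (A *v (y - xstar))"
      using least_squares_normal_equation[OF opt, of "y - xstar"]
      by (simp add: power2_norm_eq_inner matrix_vector_mult_diff_distrib inner_diff_left)
    finally have "(sigma_min A)\<^sup>2 * (norm (y - xstar))\<^sup>2 / real CARD('m)
        \<le> (A *v y - b) \<bullet> (A *v (y - xstar)) / real CARD('m)"
      by (intro divide_right_mono) (simp_all add: power_mult_distrib)
    then show "\<mu> * (norm (y - xstar))\<^sup>2 \<le> ?E (\<lambda>d. ?g d \<bullet> (y - xstar))"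
      unfolding expectation_msgd_update_inner[OF p] \<mu> by simp
  qed (use \<alpha> in auto)
  finally show ?thesis
    by (simp add: algebra_simps)
qed

text \<open>
  The factor \<open>1 - 2 / k\<close> is negative for \<open>k = 1\<close>, which makes the induction start without any
  bound on \<open>D 1\<close>, and vanishes for \<open>k = 2\<close>.
\<close>

lemma reciprocal_bound_of_recursion:
  fixes D :: "nat \<Rightarrow> real"
  assumes nonneg: "0 \<le> D 1" and C: "0 \<le> C"
    and rec: "\<And>k. 1 \<le> k \<Longrightarrow> D (Suc k) \<le> (1 - 2 / real k) * D k + C / (real k)\<^sup>2"
    and "1 \<le> k"
  shows "D (Suc k) \<le> C / real k"
  using \<open>1 \<le> k\<close>
proof (induction k rule: dec_induct)
  case base
  show ?case using rec[of 1] nonneg by simp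
next
  case (step k)
  let ?k = "real k"
  have k: "1 \<le> ?k" using step.hyps by simp
  have "D (Suc (Suc k)) \<le> (1 - 2 / (?k + 1)) * D (Suc k) + C / (?k + 1)\<^sup>2"
    using rec[of "Suc k"] by (simp add: add.commute)
  \<comment> \<open>The induction hypothesis may be inserted because the factor is nonnegative once
    \<open>?k\<close> is at least 1.\<close>
  also have "\<dots> \<le> (1 - 2 / (?k + 1)) * (C / ?k) + C / (?k + 1)\<^sup>2"
    using k step.IH by (intro add_right_mono mult_left_mono) (auto simp: field_simps)
  also have "\<dots> = C / (?k + 1) - C / (?k * (?k + 1)\<^sup>2)"
    using k by (simp add: divide_simps power2_eq_square) (simp add: algebra_simps)
  also have "\<dots> \<le> C / (?k + 1)"
    using k C by simp
  finally show ?case by (simp add: add.commute)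
qed

section \<open>Convergence of the iterates\<close>

theorem theorem1:
  fixes A :: "complex^'n^'m" and b :: "complex^'m" and p :: real
    and W :: "(complex^'n) set" and B \<mu> G :: real and xstar x1 :: "complex^'n"
    and M :: "'w measure"
    and \<xi> :: "nat \<Rightarrow> 'w \<Rightarrow> 'm \<times> ('m \<times> 'n \<Rightarrow> bool)"
    and x :: "nat \<Rightarrow> 'w \<Rightarrow> complex^'n"
  assumes "CARD('m) > CARD('n)"
    and "rank A = min CARD('m) CARD('n)"
    and "0 < p" and "p \<le> 1"
    and "is_arg_min (\<lambda>y. 1 / (2 * real CARD('m)) * (norm (A *v y - b))\<^sup>2) (\<lambda>_. True) xstar"
    and "closed W" and "convex W" and "xstar \<in> W"
    and "B \<in> (\<lambda>y. (norm y)\<^sup>2) ` W" and "\<And>y. y \<in> W \<Longrightarrow> (norm y)\<^sup>2 \<le> B"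
    and "\<mu> = (sigma_min A)\<^sup>2 / real CARD('m)"
    and "G = 2 * B / (real CARD('m) * p\<^sup>2) * (1 + (1 - p) * (2 - p) / p)
               * (\<Sum>i\<in>UNIV. norm (row i A) ^ 4)
             + 2 / (real CARD('m) * p\<^sup>2) * (\<Sum>i\<in>UNIV. (norm (row i A))\<^sup>2 * (norm (b $ i))\<^sup>2)"
    and "prob_space M"
    and "prob_space.indep_vars M (\<lambda>_. count_space UNIV) \<xi> {1..}"
    and "\<And>k. k \<ge> 1 \<Longrightarrow> distr M (count_space UNIV) (\<xi> k) = measure_pmf (draw_pmf p)"
    and "x1 \<in> W"
    and "\<And>\<omega>. \<omega> \<in> space M \<Longrightarrow> x 1 \<omega> = x1"
    and "\<And>k \<omega>. k \<ge> 1 \<Longrightarrow> \<omega> \<in> space M \<Longrightarrow>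
           x (Suc k) \<omega> =
             closest_point W (x k \<omega> - (1 / (\<mu> * real k)) *\<^sub>R msgd_update p A b (\<xi> k \<omega>) (x k \<omega>))"
  shows "(\<forall>k\<ge>1. prob_space.expectation M (\<lambda>\<omega>. (norm (x (Suc k) \<omega> - xstar))\<^sup>2)
                 \<le> 17 * G * (1 + ln (real k)) / (\<mu>\<^sup>2 * real k))
       \<and> (\<forall>y\<in>W. measure_pmf.expectation (draw_pmf p) (\<lambda>d. (norm (msgd_update p A b d y))\<^sup>2) \<le> G)"
proof (intro conjI allI impI ballI)
  note p = assms(3,4)
  have opt: "norm (A *v xstar - b) \<le> norm (A *v y - b)" for y
  proof -
    have "\<not> 1 / (2 * real CARD('m)) * (norm (A *v y - b))\<^sup>2 < 1 / (2 * real CARD('m)) * (norm (A *v xstar - b))\<^sup>2"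
      using assms(5) by (simp only: is_arg_min_def) blast
    then show ?thesis
      by (simp add: not_less divide_le_cancel power_mono_iff)
  qed
  have g: "measure_pmf.expectation (draw_pmf p) (\<lambda>d. (norm (msgd_update p A b d y))\<^sup>2) \<le> G" if "y \<in> W" for y
    unfolding assms(12) by (rule expectation_norm_msgd_update_le[OF p assms(10)[OF that]])
  then show "measure_pmf.expectation (draw_pmf p) (\<lambda>d. (norm (msgd_update p A b d y))\<^sup>2) \<le> G" if "y \<in> W" for y
    using that .
  \<comment> \<open>\<open>G\<close> dominates a mean square at the point \<open>xstar\<close> of
    \<open>W\<close>.\<close>
  have "0 \<le> G"
    by (rule order_trans[OF _ g[OF assms(8)]]) simp
  have sm: "0 < sigma_min A"
    using assms(1,2) by (intro sigma_min_pos) simp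
  then have "0 < \<mu>" by (simp add: assms(11))
  interpret prob_space M by fact
  define T where "T k d y = closest_point W (y - (1 / (\<mu> * real k)) *\<^sub>R msgd_update p A b d y)" for k d y
  have step: "x (Suc k) \<omega> = T k (\<xi> k \<omega>) (x k \<omega>)" if "1 \<le> k" "\<omega> \<in> space M" for k \<omega>
    using assms(18)[OF that] by (simp add: T_def)
  \<comment> \<open>The second-moment bound holds on \<open>W\<close> only, so it applies along the
    iterates once they are known to stay there.\<close>
  have xW: "x k \<omega> \<in> W" if "1 \<le> k" "\<omega> \<in> space M" for k \<omega>
    using that(1)
  proof (induction k rule: dec_induct)
    case base
    then show ?case using assms(16,17) that(2) by simp
  next
    case (step k)
    then show ?case
      using assms(6,8) assms(18)[OF _ that(2), of k] by (auto intro: closest_point_in_set)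
  qed
  note integrable_x = integrable_iterate[where X = x and T = T and \<xi> = \<xi>, OF assms(14,15,17) step]
    and expectation_step = expectation_iterate_step[where X = x and T = T and \<xi> = \<xi>, OF assms(14,15,17) step]
  define D where "D k = expectation (\<lambda>\<omega>. (norm (x k \<omega> - xstar))\<^sup>2)" for k
  have rec: "D (Suc k) \<le> (1 - 2 / real k) * D k + G / \<mu>\<^sup>2 / (real k)\<^sup>2" if k: "1 \<le> k" for k
  proof -
    have "D (Suc k) = expectation (\<lambda>\<omega>. (norm (T k (\<xi> k \<omega>) (x k \<omega>) - xstar))\<^sup>2)"
      unfolding D_def using step[OF k] by (intro Bochner_Integration.integral_cong) auto
    also have "\<dots> = expectation (\<lambda>\<omega>. measure_pmf.expectation (draw_pmf p) (\<lambda>d. (norm (T k d (x k \<omega>) - xstar))\<^sup>2))"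
      using k by (intro expectation_step[of k "\<lambda>d y. (norm (T k d y - xstar))\<^sup>2"])
    also have "\<dots> \<le> expectation (\<lambda>\<omega>. (1 - 2 / real k) * (norm (x k \<omega> - xstar))\<^sup>2 + G / \<mu>\<^sup>2 / (real k)\<^sup>2)"
    proof (rule integral_mono)
      fix \<omega> assume \<omega>: "\<omega> \<in> space M"
      show "measure_pmf.expectation (draw_pmf p) (\<lambda>d. (norm (T k d (x k \<omega>) - xstar))\<^sup>2)
          \<le> (1 - 2 / real k) * (norm (x k \<omega> - xstar))\<^sup>2 + G / \<mu>\<^sup>2 / (real k)\<^sup>2"
        \<comment> \<open>This step size turns the contraction factor into
          \<open>1 - 2 / real k\<close>, free of \<open>\<mu>\<close>.\<close>
        using expected_projected_step_le[OF p opt assms(6-8,11) g[OF xW[OF k \<omega>]], of "1 / (\<mu> * real k)"]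
          \<open>0 < \<mu>\<close>
        by (simp add: T_def power_divide power_mult_distrib)
    next
      show "integrable M (\<lambda>\<omega>. measure_pmf.expectation (draw_pmf p) (\<lambda>d. (norm (T k d (x k \<omega>) - xstar))\<^sup>2))"
        using k by (intro integrable_x[of k "\<lambda>y. measure_pmf.expectation (draw_pmf p) (\<lambda>d. (norm (T k d y - xstar))\<^sup>2)"])
      show "integrable M (\<lambda>\<omega>. (1 - 2 / real k) * (norm (x k \<omega> - xstar))\<^sup>2 + G / \<mu>\<^sup>2 / (real k)\<^sup>2)"
        using k by (intro integrable_x[of k "\<lambda>y. (1 - 2 / real k) * (norm (y - xstar))\<^sup>2 + G / \<mu>\<^sup>2 / (real k)\<^sup>2"])
    qed
    also have "\<dots> = (1 - 2 / real k) * D k + G / \<mu>\<^sup>2 / (real k)\<^sup>2"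
      using integrable_x[of k "\<lambda>y. (norm (y - xstar))\<^sup>2"] k by (simp add: D_def prob_space)
    finally show ?thesis .
  qed
  fix k :: nat
  assume k: "1 \<le> k"
  have "D (Suc k) \<le> G / \<mu>\<^sup>2 / real k"
    using \<open>0 \<le> G\<close> by (intro reciprocal_bound_of_recursion[OF _ _ rec k]) (simp_all add: D_def)
  \<comment> \<open>Pure loosening: the extra factor is at least 1 because
    \<open>ln (real k)\<close> is nonnegative.\<close>
  also have "\<dots> \<le> 17 * (1 + ln (real k)) * (G / \<mu>\<^sup>2 / real k)"
  proof -
    have "1 \<le> 17 * (1 + ln (real k))"
      using ln_ge_zero[of "real k"] k by simp
    then show ?thesis
      using mult_right_mono[of 1 "17 * (1 + ln (real k))" "G / \<mu>\<^sup>2 / real k"] \<open>0 \<le> G\<close> by simp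
  qed
  finally show "expectation (\<lambda>\<omega>. (norm (x (Suc k) \<omega> - xstar))\<^sup>2) \<le> 17 * G * (1 + ln (real k)) / (\<mu>\<^sup>2 * real k)"
    by (simp add: D_def mult_ac)
qed

end
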